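(* Let $K\ge 2$ and let $\bm p$ be a strictly positive probability distribution on triples $(a,x,y)\in\{1,\dots,K\}^3$. Let $\bm p^*$ be obtained from $\bm p$ by an intervention on the cause $X$, i.e. for some strictly positive distribution $\bm p^*(x)$ on $\{1,\dots,K\}$, $$\bm p^*(a,x,y)=\bm p(a)\,\bm p^*(x)\,\bm p(y\mid a,x)\qquad\text{for all }a,x,y$$ (equivalently, the causal scores $\mathbf s_{X|a}$ are replaced, for every $a$, by one common vector $\mathbf s^*_X$, while $\mathbf s_A$ and $\mathbf s_{Y|A,X}$ are unchanged). Let $\delta_{\text{causal}}=\|\theta_\rightarrow^{(0)}-\theta_\rightarrow^*\|^2$ and $\delta_{\text{anticausal}}=\|\theta_\leftarrow^{(0)}-\theta_\leftarrow^*\|^2$ be the squared distances between the parameters of $\bm p$ and of $\bm p^*$ in the causal and anti-causal parametrizations. Then $$\delta_{\text{anticausal}}\ \ge\ K\,\delta_{\text{causal}}.$$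
   Context: $A$ (bias / sensitive variable), $X$ (cause), $Y$ (effect) are categorical variables with values in $\{1,\dots,K\}$. Scores: a strictly positive distribution $(p_z)_{z=1}^K$ is represented by its score vector $\mathbf s=(s_z)_{z=1}^K\in\mathbb R^K$ with $p_z=e^{s_z}/\sum_{z'}e^{s_{z'}}$, normalized by $\sum_z s_z=0$ (so the score vector is uniquely determined by the distribution). For a joint distribution $\bm p(a,x,y)$ write $\mathbf s_A=(s_a)_a$ for the score of the marginal $\bm p(a)$; $\mathbf s_{X|a}=(s_{x|a})_x$ for the score of $\bm p(x\mid a)$; $\mathbf s_{Y|a}=(s_{y|a})_y$ for the score of $\bm p(y\mid a)$; $\mathbf s_{Y|a,x}=(s_{y|a,x})_y$ for the score of $\bm p(y\mid a,x)$; $\mathbf s_{X|a,y}=(s_{x|a,y})_x$ for the score of $\bm p(x\mid a,y)$. Each of these vectors sums to zero. Starred quantities are the corresponding scores of $\bm p^*$. Causal parametrization (factorization $\bm p(a)\bm p(x|a)\bm p(y|a,x)$): $\theta_\rightarrow=(\mathbf s_A,(\mathbf s_{X|a})_a,(\mathbf s_{Y|a,x})_{a,x})$. Anti-causal parametrization (factorization $\bm p(a)\bm p(y|a)\bm p(x|a,y)$): $\theta_\leftarrow=(\mathbf s_A,(\mathbf s_{Y|a})_a,(\mathbf s_{X|a,y})_{a,y})$. The superscript $(0)$ denotes the parameters of $\bm p$ and the superscript $*$ those of $\bm p^*$. Norms are Euclidean norms over all coordinates, so that $$\delta_{\text{causal}}=\|\mathbf s_A-\mathbf s_A^*\|^2+\sum_a\|\mathbf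 s_{X|a}-\mathbf s^*_{X|a}\|^2+\sum_{a,x}\|\mathbf s_{Y|a,x}-\mathbf s^*_{Y|a,x}\|^2,$$ $$\delta_{\text{anticausal}}=\|\mathbf s_A-\mathbf s_A^*\|^2+\sum_a\|\mathbf s_{Y|a}-\mathbf s^*_{Y|a}\|^2+\sum_{a,y}\|\mathbf s_{X|a,y}-\mathbf s^*_{X|a,y}\|^2.$$ *)

theory Defs
  imports "HOL-Probability.Probability"
begin

text \<open>
  The index set \<open>{1..K}\<close> is an arbitrary finite type \<open>'k\<close> with \<open>K = CARD('k)\<close>. A joint distribution
  of \<open>(A, X, Y)\<close> is a pmf on \<open>'k \<times> 'k \<times> 'k\<close>; ``strictly positive'' is \<open>set_pmf p = UNIV\<close>.
\<close>

definition is_score :: "'k::finite pmf \<Rightarrow> real ^ 'k \<Rightarrow> bool" where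
  "is_score p s \<longleftrightarrow>
     (\<forall>z. pmf p z = exp (s $ z) / (\<Sum>z'\<in>UNIV. exp (s $ z'))) \<and> (\<Sum>z\<in>UNIV. s $ z) = 0"

text \<open>Meaningful only for strictly positive \<open>p\<close>, see \<open>ex1_is_score\<close> below.\<close>

definition score :: "'k::finite pmf \<Rightarrow> real ^ 'k" where
  "score p = (THE s. is_score p s)"

definition marginal_A :: "('k \<times> 'k \<times> 'k) pmf \<Rightarrow> 'k pmf" where
  "marginal_A p = map_pmf fst p"

definition cond_X_given_A :: "('k \<times> 'k \<times> 'k) pmf \<Rightarrow> 'k \<Rightarrow> 'k pmf" where
  "cond_X_given_A p a = map_pmf (\<lambda>(_, x, _). x) (cond_pmf p {(a', _, _). a' = a})"

definition cond_Y_given_A :: "('k \<times> 'k \<times> 'k) pmf \<Rightarrow> 'k \<Rightarrow> 'k pmf" where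
  "cond_Y_given_A p a = map_pmf (\<lambda>(_, _, y). y) (cond_pmf p {(a', _, _). a' = a})"

definition cond_Y_given_AX :: "('k \<times> 'k \<times> 'k) pmf \<Rightarrow> 'k \<Rightarrow> 'k \<Rightarrow> 'k pmf" where
  "cond_Y_given_AX p a x =
     map_pmf (\<lambda>(_, _, y). y) (cond_pmf p {(a', x', _). a' = a \<and> x' = x})"

definition cond_X_given_AY :: "('k \<times> 'k \<times> 'k) pmf \<Rightarrow> 'k \<Rightarrow> 'k \<Rightarrow> 'k pmf" where
  "cond_X_given_AY p a y =
     map_pmf (\<lambda>(_, x, _). x) (cond_pmf p {(a', _, y'). a' = a \<and> y' = y})"

text \<open>
  The library norms on \<open>real ^ 'n\<close>, on iterated vectors and on products are all Euclidean, so the norm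
  on the parameter space is the Euclidean norm over all coordinates
  (\<open>delta_causal_eq\<close>, \<open>delta_anticausal_eq\<close>).
\<close>

type_synonym 'k params = "(real ^ 'k) \<times> (real ^ 'k ^ 'k) \<times> (real ^ 'k ^ 'k ^ 'k)"

definition theta_causal :: "('k::finite \<times> 'k \<times> 'k) pmf \<Rightarrow> 'k params" where
  "theta_causal p =
     (score (marginal_A p),
      \<chi> a. score (cond_X_given_A p a),
      \<chi> a x. score (cond_Y_given_AX p a x))"

definition theta_anticausal :: "('k::finite \<times> 'k \<times> 'k) pmf \<Rightarrow> 'k params" where
  "theta_anticausal p =
     (score (marginal_A p),
      \<chi> a. score (cond_Y_given_A p a),
      \<chi> a y. score (cond_X_given_AY p a y))"

definition delta_causal :: "('k::finite \<times> 'k \<times> 'k) pmf \<Rightarrow> ('k \<times> 'k \<times> 'k) pmf \<Rightarrow> real" where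
  "delta_causal p pstar = (norm (theta_causal p - theta_causal pstar))\<^sup>2"

definition delta_anticausal :: "('k::finite \<times> 'k \<times> 'k) pmf \<Rightarrow> ('k \<times> 'k \<times> 'k) pmf \<Rightarrow> real" where
  "delta_anticausal p pstar = (norm (theta_anticausal p - theta_anticausal pstar))\<^sup>2"

definition cause_intervention ::
  "('k \<times> 'k \<times> 'k) pmf \<Rightarrow> 'k pmf \<Rightarrow> ('k \<times> 'k \<times> 'k) pmf \<Rightarrow> bool" where
  "cause_intervention p q pstar \<longleftrightarrow>
     (\<forall>a x y. pmf pstar (a, x, y) = pmf (marginal_A p) a * pmf q x * pmf (cond_Y_given_AX p a x) y)"

lemma ex1_is_score:
  assumes "set_pmf p = UNIV"
  shows "\<exists>!s. is_score p s"
proof (rule ex1I)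
  have pos: "pmf p z > 0" for z
    using assms by (simp add: pmf_positive)
  define m where "m = (\<Sum>z\<in>UNIV. ln (pmf p z)) / CARD('a)"
  have e: "exp (ln (pmf p z) - m) = pmf p z / exp m" for z
    using pos by (simp add: exp_diff)
  have one: "(\<Sum>z\<in>UNIV. pmf p z) = 1"
    by (rule sum_pmf_eq_1) auto
  show "is_score p (\<chi> z. ln (pmf p z) - m)"
    using one by (simp add: is_score_def e flip: sum_divide_distrib)
      (simp add: sum_subtractf m_def)
  fix s assume s: "is_score p s"
  define S where "S = (\<Sum>z'\<in>UNIV. exp (s $ z'))"
  have "S > 0" unfolding S_def by (intro sum_pos) auto
  have ln: "ln (pmf p z) = s $ z - ln S" for z
    using s \<open>S > 0\<close> by (simp add: is_score_def ln_div flip: S_def)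
  have "(\<Sum>z\<in>UNIV. ln (pmf p z)) = - (CARD('a) * ln S)"
    unfolding ln using s by (simp add: sum_subtractf is_score_def)
  then have "m = - ln S" by (simp add: m_def)
  then show "s = (\<chi> z. ln (pmf p z) - m)"
    by (simp add: vec_eq_iff ln)
qed

lemma norm_vec_sq: "(norm (v :: 'b::real_normed_vector ^ 'n))\<^sup>2 = (\<Sum>i\<in>UNIV. (norm (v $ i))\<^sup>2)"
  by (simp add: norm_vec_def L2_set_def sum_nonneg)

lemma norm_pair_sq: "(norm (u, v))\<^sup>2 = (norm u)\<^sup>2 + (norm v)\<^sup>2"
  by (simp add: norm_prod_def)

lemma delta_causal_eq:
  "delta_causal p pstar =
     (norm (score (marginal_A p) - score (marginal_A pstar)))\<^sup>2
     + (\<Sum>a\<in>UNIV. (norm (score (cond_X_given_A p a) - score (cond_X_given_A pstar a)))\<^sup>2)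
     + (\<Sum>a\<in>UNIV. \<Sum>x\<in>UNIV.
          (norm (score (cond_Y_given_AX p a x) - score (cond_Y_given_AX pstar a x)))\<^sup>2)"
  by (simp add: delta_causal_def theta_causal_def norm_pair_sq norm_vec_sq)

lemma delta_anticausal_eq:
  "delta_anticausal p pstar =
     (norm (score (marginal_A p) - score (marginal_A pstar)))\<^sup>2
     + (\<Sum>a\<in>UNIV. (norm (score (cond_Y_given_A p a) - score (cond_Y_given_A pstar a)))\<^sup>2)
     + (\<Sum>a\<in>UNIV. \<Sum>y\<in>UNIV.
          (norm (score (cond_X_given_AY p a y) - score (cond_X_given_AY pstar a y)))\<^sup>2)"
  by (simp add: delta_anticausal_def theta_anticausal_def norm_pair_sq norm_vec_sq)

end

theory Submission
  imports Defs
begin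

text \<open>
  By Bayes' rule, \<open>p(x | a, y)\<close> is proportional to \<open>p(x | a) p(y | a, x)\<close> as a function of \<open>x\<close>. The
  intervention keeps \<open>p(y | a, x)\<close>, so for every \<open>y\<close> the score of \<open>X\<close> given \<open>a, y\<close> moves by the same
  vector as the score of \<open>X\<close> given \<open>a\<close>. Only the latter contributes to the causal distance, and
  summing over \<open>y\<close> counts it \<open>K\<close> times in the anti-causal one.
\<close>

text \<open>Taking logarithms turns the normalizer into an additive constant, and the zero-sum
  condition fixes that constant as the mean log-mass. This replaces the definite description by a
  closed form.\<close>

lemma score_eq_centered_ln:
  fixes p :: "'k::finite pmf"
  assumes "set_pmf p = UNIV"
  shows "score p = (\<chi> z. ln (pmf p z) - (\<Sum>z'\<in>UNIV. ln (pmf p z')) / CARD('k))"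
proof -
  have pos: "pmf p z > 0" for z
    using assms by (simp add: pmf_positive)
  have s: "is_score p (score p)"
    unfolding score_def by (rule theI'[OF ex1_is_score[OF assms]])
  define S where "S = (\<Sum>z\<in>UNIV. exp (score p $ z))"
  have "S > 0" unfolding S_def by (intro sum_pos) auto
  then have ln: "ln (pmf p z) = score p $ z - ln S" for z
    using s by (simp add: is_score_def ln_div flip: S_def)
  have "(\<Sum>z\<in>UNIV. ln (pmf p z)) = - (CARD('k) * ln S)"
    unfolding ln using s by (simp add: sum_subtractf is_score_def)
  then show ?thesis by (simp add: vec_eq_iff ln)
qed

text \<open>The factor \<open>C\<close> becomes a summand \<open>ln C\<close> common to all
  \<open>z\<close>, and centering removes it. Hence factors constant in \<open>z\<close>, such as
  the normalizers in Bayes' rule, do not affect score differences.\<close>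

lemma score_diff_cong:
  fixes u u' v v' :: "'k::finite pmf"
  assumes pos: "set_pmf u = UNIV" "set_pmf u' = UNIV" "set_pmf v = UNIV" "set_pmf v' = UNIV"
    and ratio: "\<And>z. pmf u z / pmf u' z = C * (pmf v z / pmf v' z)"
  shows "score u - score u' = score v - score v'"
proof -
  have pos': "pmf u z > 0" "pmf u' z > 0" "pmf v z > 0" "pmf v' z > 0" for z
    using pos by (simp_all add: pmf_positive)
  \<comment> \<open>The sign of \<open>C\<close> is forced by the ratio equation between positive
    masses; it is needed to split the logarithm of the product.\<close>
  have "C * (pmf v z / pmf v' z) > 0" for z
    unfolding ratio[symmetric] using pos' by simp
  then have C: "C > 0"
    using pos' by (metis divide_pos_pos zero_less_mult_pos2)
  have ln: "ln (pmf u z) = ln C + ln (pmf v z) - ln (pmf v' z) + ln (pmf u' z)" for z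
  proof -
    have "ln (pmf u z / pmf u' z) = ln (C * (pmf v z / pmf v' z))"
      by (simp only: ratio)
    then show ?thesis
      using C pos'[of z] by (simp add: ln_div ln_mult)
  qed
  show ?thesis
    by (simp add: score_eq_centered_ln pos vec_eq_iff ln sum.distrib sum_subtractf field_simps)
qed

text \<open>Since \<open>S\<close> meets the support it has positive mass, so conditioning is
  ordinary division. The conditional masses below are computed from this.\<close>

lemma measure_cond_pmf_eq:
  assumes "set_pmf p \<inter> S \<noteq> {}"
  shows "measure (measure_pmf (cond_pmf p S)) T
    = measure (measure_pmf p) (S \<inter> T) / measure (measure_pmf p) S"
proof -
  have "emeasure (measure_pmf p) S \<noteq> 0"
    using assms by (auto simp: measure_pmf.emeasure_eq_measure measure_pmf_zero_iff)
  then show ?thesis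
    using assms by (simp add: cond_pmf.rep_eq)
qed

lemma pmf_marginal_A:
  fixes p :: "('k::finite \<times> 'k \<times> 'k) pmf"
  shows "pmf (marginal_A p) a = (\<Sum>x\<in>UNIV. \<Sum>y\<in>UNIV. pmf p (a, x, y))"
proof -
  have "pmf (marginal_A p) a = measure p ({a} \<times> UNIV \<times> UNIV)"
    by (auto simp: marginal_A_def pmf_map intro!: arg_cong[where f = "measure p"])
  then show ?thesis
    by (simp add: measure_measure_pmf_finite sum.cartesian_product' del: UNIV_Times_UNIV)
qed

context
  fixes p :: "('k::finite \<times> 'k \<times> 'k) pmf"
  assumes pos: "set_pmf p = UNIV"
begin

lemma pmf_joint_pos: "pmf p w > 0"
  using pos by (simp add: pmf_positive)

lemma pmf_cond_X_given_A:
  "pmf (cond_X_given_A p a) x = (\<Sum>y\<in>UNIV. pmf p (a, x, y)) / pmf (marginal_A p) a"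
proof -
  let ?S = "{(a', _, _). a' = a} :: ('k \<times> 'k \<times> 'k) set"
  have eq: "pmf (cond_X_given_A p a) x
      = measure p (?S \<inter> (\<lambda>(_, x, _). x) -` {x}) / measure p ?S"
    unfolding cond_X_given_A_def pmf_map by (intro measure_cond_pmf_eq) (auto simp: pos)
  \<comment> \<open>As a preimage under \<open>fst\<close>, the conditioning event has as its
    measure the mass of \<open>marginal_A p\<close> at \<open>a\<close>.\<close>
  have sets: "?S \<inter> (\<lambda>(_, x, _). x) -` {x} = {a} \<times> {x} \<times> UNIV" "?S = fst -` {a}"
    by auto
  show ?thesis
    unfolding eq sets(1) unfolding sets(2)
    by (simp add: measure_measure_pmf_finite sum.cartesian_product' marginal_A_def pmf_map)
qed

lemma pmf_cond_Y_given_AX: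
  "pmf (cond_Y_given_AX p a x) y = pmf p (a, x, y) / (\<Sum>y'\<in>UNIV. pmf p (a, x, y'))"
proof -
  let ?S = "{(a', x', _). a' = a \<and> x' = x} :: ('k \<times> 'k \<times> 'k) set"
  have eq: "pmf (cond_Y_given_AX p a x) y
      = measure p (?S \<inter> (\<lambda>(_, _, y). y) -` {y}) / measure p ?S"
    unfolding cond_Y_given_AX_def pmf_map by (intro measure_cond_pmf_eq) (auto simp: pos)
  have sets: "?S \<inter> (\<lambda>(_, _, y). y) -` {y} = {(a, x, y)}" "?S = {a} \<times> {x} \<times> UNIV"
    by auto
  show ?thesis
    unfolding eq sets(1) unfolding sets(2)
    by (simp add: measure_measure_pmf_finite sum.cartesian_product')
qed

lemma pmf_cond_X_given_AY:
  "pmf (cond_X_given_AY p a y) x = pmf p (a, x, y) / (\<Sum>x'\<in>UNIV. pmf p (a, x', y))"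
proof -
  let ?S = "{(a', _, y'). a' = a \<and> y' = y} :: ('k \<times> 'k \<times> 'k) set"
  have eq: "pmf (cond_X_given_AY p a y) x
      = measure p (?S \<inter> (\<lambda>(_, x, _). x) -` {x}) / measure p ?S"
    unfolding cond_X_given_AY_def pmf_map by (intro measure_cond_pmf_eq) (auto simp: pos)
  have sets: "?S \<inter> (\<lambda>(_, x, _). x) -` {x} = {(a, x, y)}" "?S = {a} \<times> UNIV \<times> {y}"
    by auto
  show ?thesis
    unfolding eq sets(1) unfolding sets(2)
    by (simp add: measure_measure_pmf_finite sum.cartesian_product')
qed

lemma sums_joint_pos:
  "(\<Sum>y\<in>UNIV. pmf p (a, x, y)) > 0" "(\<Sum>x\<in>UNIV. pmf p (a, x, y)) > 0"
  "pmf (marginal_A p) a > 0"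
  by (auto simp: pmf_marginal_A pmf_joint_pos intro!: sum_pos)

lemma set_pmf_cond_eq_UNIV:
  "set_pmf (cond_X_given_A p a) = UNIV" "set_pmf (cond_Y_given_AX p a x) = UNIV"
  "set_pmf (cond_X_given_AY p a y) = UNIV"
  by (auto simp: set_pmf_eq pmf_cond_X_given_A pmf_cond_Y_given_AX pmf_cond_X_given_AY
      less_imp_neq[OF pmf_joint_pos, symmetric] less_imp_neq[OF sums_joint_pos(1), symmetric]
      less_imp_neq[OF sums_joint_pos(2), symmetric] less_imp_neq[OF sums_joint_pos(3), symmetric])

text \<open>The chain rule in causal order: the same shape as the intervened distribution, with p(x
  | a) in the place of \<open>q\<close>.\<close>

lemma pmf_joint_factor:
  "pmf p (a, x, y) = pmf (marginal_A p) a * pmf (cond_X_given_A p a) x * pmf (cond_Y_given_AX p a x) y"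
  using sums_joint_pos(1)[of a x] sums_joint_pos(3)[of a]
  by (simp add: pmf_cond_X_given_A pmf_cond_Y_given_AX)

end

theorem proposition1:
  fixes p pstar :: "('k::finite \<times> 'k \<times> 'k) pmf" and q :: "'k pmf"
  assumes "CARD('k) \<ge> 2"
    and "set_pmf p = UNIV"
    and "set_pmf q = UNIV"
    and "cause_intervention p q pstar"
  shows "delta_anticausal p pstar \<ge> real CARD('k) * delta_causal p pstar"
proof -
  note p = assms(2)
  have pstar_eq: "pmf pstar (a, x, y)
      = pmf (marginal_A p) a * pmf q x * pmf (cond_Y_given_AX p a x) y" for a x y
    using assms(4) by (simp add: cause_intervention_def)
  have q_pos: "pmf q x > 0" for x
    using assms(3) by (simp add: pmf_positive)
  have Y_pos: "pmf (cond_Y_given_AX p a x) y > 0" for a x y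
    using set_pmf_cond_eq_UNIV(2)[OF p] by (simp add: pmf_positive)
  have A_pos: "pmf (marginal_A p) a > 0" for a
    by (rule sums_joint_pos(3)[OF p])
  have pstar: "set_pmf pstar = UNIV"
    using q_pos Y_pos A_pos by (auto simp: set_pmf_eq pstar_eq less_imp_neq[symmetric])
  have sum_one: "(\<Sum>z\<in>UNIV. pmf r z) = 1" for r :: "'k pmf"
    by (rule sum_pmf_eq_1) auto
  \<comment> \<open>After the intervention A and X are independent with laws
    \<open>marginal_A p\<close> and \<open>q\<close>; the three identities that follow are read off
    from this.\<close>
  have sum_y: "(\<Sum>y\<in>UNIV. pmf pstar (a, x, y)) = pmf (marginal_A p) a * pmf q x" for a x
    by (simp add: pstar_eq sum_one flip: sum_distrib_left)
  have A: "marginal_A pstar = marginal_A p"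
    by (rule pmf_eqI)
      (simp add: pmf_marginal_A sum_y sum_one flip: sum_distrib_left)
  have X: "cond_X_given_A pstar a = q" for a
    using A_pos[of a] by (intro pmf_eqI) (simp add: pmf_cond_X_given_A[OF pstar] sum_y A)
  have Y: "cond_Y_given_AX pstar a x = cond_Y_given_AX p a x" for a x
    using A_pos[of a] q_pos[of x]
    by (intro pmf_eqI) (simp only: pmf_cond_Y_given_AX[OF pstar] sum_y, simp add: pstar_eq)
  have XAY: "score (cond_X_given_AY p a y) - score (cond_X_given_AY pstar a y)
      = score (cond_X_given_A p a) - score q" for a y
  proof (rule score_diff_cong)
    fix x
    \<comment> \<open>The constant is the quotient p*(a,y) / p(a,y) of the Bayes normalizers, free
      of \<open>x\<close>. Only the numerators are factored, and there p(a) p(y | a,x)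
      cancels.\<close>
    show "pmf (cond_X_given_AY p a y) x / pmf (cond_X_given_AY pstar a y) x
      = (\<Sum>x\<in>UNIV. pmf pstar (a, x, y)) / (\<Sum>x\<in>UNIV. pmf p (a, x, y))
        * (pmf (cond_X_given_A p a) x / pmf q x)"
      unfolding pmf_cond_X_given_AY[OF p] pmf_cond_X_given_AY[OF pstar]
        pstar_eq[of a x y] pmf_joint_factor[OF p, of a x y]
      using A_pos[of a] Y_pos[of a x y] by simp
  qed (simp_all add: p pstar assms(3) set_pmf_cond_eq_UNIV)
  \<comment> \<open>Only the X given A term of the causal distance survives; by \<open>XAY\<close>
    the summand on the right is constant in \<open>y\<close>, which yields the factor K.\<close>
  have "real CARD('k) * delta_causal p pstar
      = (\<Sum>a\<in>UNIV. \<Sum>y\<in>UNIV.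
          (norm (score (cond_X_given_AY p a y) - score (cond_X_given_AY pstar a y)))\<^sup>2)"
    by (simp add: delta_causal_eq A X Y XAY sum_distrib_left)
  \<comment> \<open>The A term is zero, so the slack is exactly the squared change of the scores of
    Y given A.\<close>
  also have "\<dots> \<le> delta_anticausal p pstar"
    by (simp add: delta_anticausal_eq sum_nonneg)
  finally show ?thesis .
qed

end
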